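(* Let $G=(V,E)$ be an infinite, connected graph with countable vertex set. Assume that $\partial_V^{n+1}\ge\partial_V^n\ge\partial_V^1\ge 2$ for all $n\ge 1$ and that all vertices have degree $\deg(v)\le D$. Suppose that $v_1,v_2,\dots$ is an enumeration of the vertices (each vertex occurring exactly once) such that, for some constant $c>0$ and all $n\ge 1$, $$\partial_V(\{v_1,\dots,v_n\})\subseteq\{v_j: n+1\le j\le n+c\cdot\partial_V^n\}.$$ Then for the rearrangement $f\mapsto f^*$ defined by this enumeration, all $1\le p\le\infty$ and all $f:V\to\mathbb{R}$ vanishing at infinity, $$\|\nabla f^*\|_{L^p}\le (c+1)\cdot D^{1/p}\cdot\|\nabla f\|_{L^p},$$ where $1/\infty:=0$ and the inequality is understood in $[0,\infty]$.
   Context: For $X\subseteq V$, the vertex boundary is $\partial_V(X)=\{z\in V\setminus X: x\sim z\text{ for some }x\in X\}$, and the isoperimetric number is $\partial_V^n=\min_{X\subseteq V,\,|X|=n}|\partial_V(X)|$ for $n\ge 1$. For $g:V\to\mathbb{R}$ and $1\le p<\infty$, $\|\nabla g\|_{L^p}^p=\sum_{x\sim y}|g(x)-g(y)|^p$ (the sum runs once over each undirected edge), and $\|\nabla g\|_{L^\infty}=\sup_{x\sim y}|g(x)-g(y)|$. A function $f$ vanishes at infinity if $\{x\in V:|f(x)|>t\}$ is finite for every $t>0$. The rearrangement defined by an enumeration $v_1,v_2,\dots$ is $f^*(v_k):=$ the $k$-th largest value assumed by $|f|$, counted with multiplicity (that is, the largest $t\ge 0$ such that $|f(x)|\ge t$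 for at least $k$ vertices $x$). *)

theory Defs
  imports "HOL-Analysis.Analysis"
begin

text \<open>
  An undirected simple graph is a vertex set \<open>V\<close> (possibly infinite) with a set \<open>E\<close> of
  two-element subsets of \<open>V\<close>.  Functions on the vertices are total functions of which only the
  values on \<open>V\<close> matter.
\<close>

definition simple_graph :: "'a set \<Rightarrow> 'a set set \<Rightarrow> bool" where
  "simple_graph V E \<longleftrightarrow> E \<subseteq> {{x, y} |x y. x \<in> V \<and> y \<in> V \<and> x \<noteq> y}"

definition adjacent :: "'a set set \<Rightarrow> 'a \<Rightarrow> 'a \<Rightarrow> bool" where
  "adjacent E x y \<longleftrightarrow> {x, y} \<in> E"

definition connected_graph :: "'a set \<Rightarrow> 'a set set \<Rightarrow> bool" where
  "connected_graph V E \<longleftrightarrow> (\<forall>x\<in>V. \<forall>y\<in>V. (adjacent E)\<^sup>*\<^sup>* x y)"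

text \<open>
  Finiteness of the neighbourhood is stated separately, because the cardinality of an infinite
  set is \<open>0\<close>.
\<close>

definition degree_le :: "'a set \<Rightarrow> 'a set set \<Rightarrow> real \<Rightarrow> bool" where
  "degree_le V E D \<longleftrightarrow>
     (\<forall>x\<in>V. finite {y. adjacent E x y} \<and> real (card {y. adjacent E x y}) \<le> D)"

definition vertex_boundary :: "'a set \<Rightarrow> 'a set set \<Rightarrow> 'a set \<Rightarrow> 'a set" where
  "vertex_boundary V E X = {z \<in> V - X. \<exists>x\<in>X. adjacent E x z}"

text \<open>
  The infimum is taken in \<^typ>\<open>nat\<close>, so it is a minimum as soon as \<open>V\<close> has a subset of size \<open>n\<close>.
  The cardinalities are the true ones whenever all degrees are finite.
\<close>

definition isoperimetric_number :: "'a set \<Rightarrow> 'a set set \<Rightarrow> nat \<Rightarrow> nat" where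
  "isoperimetric_number V E n =
     (INF X \<in> {X. X \<subseteq> V \<and> finite X \<and> card X = n}. card (vertex_boundary V E X))"

lemma isoperimetric_number_attained:
  assumes "infinite V"
  shows "\<exists>X\<subseteq>V. finite X \<and> card X = n \<and>
           isoperimetric_number V E n = card (vertex_boundary V E X)"
proof -
  let ?S = "{X. X \<subseteq> V \<and> finite X \<and> card X = n}"
  have "?S \<noteq> {}"
    using infinite_arbitrarily_large[OF assms, of n] by blast
  then have "isoperimetric_number V E n \<in> (\<lambda>X. card (vertex_boundary V E X)) ` ?S"
    unfolding isoperimetric_number_def by (intro Inf_nat_def1) simp
  then show ?thesis
    by auto
qed

text \<open>The absolute difference of \<open>g\<close> along an undirected edge.\<close>

definition edge_diff :: "('a \<Rightarrow> real) \<Rightarrow> 'a set \<Rightarrow> real" where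
  "edge_diff g e = (THE d. \<exists>x y. e = {x, y} \<and> d = \<bar>g x - g y\<bar>)"

lemma edge_diff_doubleton: "edge_diff g {x, y} = \<bar>g x - g y\<bar>"
  unfolding edge_diff_def
  by (rule the_equality) (auto simp: doubleton_eq_iff abs_minus_commute)

text \<open>
  The real power of an extended nonnegative real, for exponents \<open>r > 0\<close> only.
\<close>

definition ennreal_power :: "ennreal \<Rightarrow> real \<Rightarrow> ennreal" where
  "ennreal_power x r = (if x = \<infinity> then \<infinity> else ennreal (enn2real x powr r))"

text \<open>\<open>\<parallel>\<nabla>g\<parallel>\<close> in \<open>L\<^sup>p\<close>, for \<open>1 \<le> p \<le> \<infinity>\<close>, as an element of \<open>[0, \<infinity>]\<close>.\<close>

definition gradient_norm :: "'a set set \<Rightarrow> ennreal \<Rightarrow> ('a \<Rightarrow> real) \<Rightarrow> ennreal" where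
  "gradient_norm E p g =
     (if p = \<infinity> then (SUP e\<in>E. ennreal (edge_diff g e))
      else ennreal_power (\<Sum>\<^sub>\<infinity>e\<in>E. ennreal (edge_diff g e powr enn2real p))
             (1 / enn2real p))"

definition vanishes_at_infinity :: "'a set \<Rightarrow> ('a \<Rightarrow> real) \<Rightarrow> bool" where
  "vanishes_at_infinity V f \<longleftrightarrow> (\<forall>t>0. finite {x \<in> V. \<bar>f x\<bar> > t})"

text \<open>
  The \<open>k\<close>-th largest value of \<open>\<bar>f\<bar>\<close> on \<open>V\<close>, counted with multiplicity.
  The set \<open>S\<close> witnesses that \<open>\<bar>f x\<bar> \<ge> t\<close> holds for at least \<open>k\<close> vertices, of which there
  may be infinitely many when \<open>t = 0\<close>.
\<close>

definition kth_largest :: "'a set \<Rightarrow> ('a \<Rightarrow> real) \<Rightarrow> nat \<Rightarrow> real" where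
  "kth_largest V f k =
     (GREATEST t. 0 \<le> t \<and> (\<exists>S\<subseteq>V. finite S \<and> card S = k \<and> (\<forall>x\<in>S. t \<le> \<bar>f x\<bar>)))"

text \<open>The enumeration \<open>v\<close> of \<open>V\<close> starts with index \<open>1\<close>.\<close>

definition rearrangement :: "'a set \<Rightarrow> (nat \<Rightarrow> 'a) \<Rightarrow> ('a \<Rightarrow> real) \<Rightarrow> 'a \<Rightarrow> real" where
  "rearrangement V v f x = kth_largest V f (inv_into {1..} v x)"

lemma rearrangement_enumeration:
  assumes "bij_betw v {1..} V" and "1 \<le> k"
  shows "rearrangement V v f (v k) = kth_largest V f k"
  using assms by (simp add: rearrangement_def bij_betw_inv_into_left)

lemma kth_largest_attained:
  assumes "infinite V" and van: "vanishes_at_infinity V f" and k: "1 \<le> k"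
  defines "P \<equiv> \<lambda>t. 0 \<le> t \<and> (\<exists>S\<subseteq>V. finite S \<and> card S = k \<and> (\<forall>x\<in>S. t \<le> \<bar>f x\<bar>))"
  shows "P (kth_largest V f k)" and "P t \<Longrightarrow> t \<le> kth_largest V f k"
proof -
  have P0: "P 0"
    using infinite_arbitrarily_large[OF assms(1), of k] by (auto simp: P_def)
  have "\<exists>m. P m \<and> (\<forall>t. P t \<longrightarrow> t \<le> m)"
  proof (cases "\<exists>s>0. P s")
    case False
    then show ?thesis using P0 by (intro exI[of _ 0]) (auto simp: not_less)
  next
    case True
    then obtain s where s: "s > 0" "P s" by blast
    define A where "A = {x \<in> V. \<bar>f x\<bar> > s / 2}"
    define mn where "mn S = Min ((\<lambda>x. \<bar>f x\<bar>) ` S)" for S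
    define M where "M = mn ` {S. S \<subseteq> A \<and> card S = k}"
    have finA: "finite A"
      using van half_gt_zero[OF s(1)] unfolding vanishes_at_infinity_def A_def by blast
    then have finM: "finite M" by (simp add: M_def)
    have low: "P m" if m: "m \<in> M" for m
    proof -
      obtain S where S: "S \<subseteq> A" "card S = k" "m = mn S"
        using m unfolding M_def by blast
      have fin: "finite S" using S(1) finA by (rule finite_subset)
      have "S \<noteq> {}" using S(2) k by auto
      have "\<forall>x\<in>S. m \<le> \<bar>f x\<bar>" using S(3) fin by (simp add: mn_def)
      moreover have "0 \<le> m" using S(3) fin \<open>S \<noteq> {}\<close> by (simp add: mn_def)
      moreover have "S \<subseteq> V" using S(1) by (auto simp: A_def)
      ultimately show ?thesis using S(2) fin unfolding P_def by blast
    qed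
    have up: "\<exists>m\<in>M. t \<le> m" if t: "P t" "s \<le> t" for t
    proof -
      obtain S where S: "S \<subseteq> V" "finite S" "card S = k" "\<forall>x\<in>S. t \<le> \<bar>f x\<bar>"
        using t(1) unfolding P_def by blast
      have SA: "S \<subseteq> A" unfolding A_def
      proof
        fix x assume "x \<in> S"
        with S(1,4) have "x \<in> V" "t \<le> \<bar>f x\<bar>" by blast+
        then show "x \<in> {x \<in> V. \<bar>f x\<bar> > s / 2}" using t(2) s(1) by simp
      qed
      have "S \<noteq> {}" using S(3) k by auto
      then have "t \<le> mn S" using S by (simp add: mn_def)
      moreover have "mn S \<in> M" using S(3) SA by (simp add: M_def)
      ultimately show ?thesis by blast
    qed
    have ne: "M \<noteq> {}" using up[OF s(2) order_refl] by blast
    have "P (Max M)" using low Max_in[OF finM ne] by blast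
    moreover have "t \<le> Max M" if "P t" for t
    proof -
      have Pmax: "P (max s t)" using s(2) that by (simp add: max_def)
      obtain m where m: "m \<in> M" "max s t \<le> m"
        using up[OF Pmax max.cobounded1] by blast
      with Max_ge[OF finM m(1)] show ?thesis by linarith
    qed
    ultimately show ?thesis by blast
  qed
  then obtain m where m: "P m" "\<And>t. P t \<Longrightarrow> t \<le> m" by blast
  have "kth_largest V f k = m"
    unfolding kth_largest_def using m[unfolded P_def] by (rule Greatest_equality)
  with m show "P (kth_largest V f k)" and "P t \<Longrightarrow> t \<le> kth_largest V f k"
    by simp_all
qed

end

theory Submission
  imports Defs
begin

text \<open>
  Write \<open>b n\<close> for the isoperimetric number, \<open>a i\<close> for the \<open>i\<close>-th largest value of \<open>\<bar>f\<bar>\<close>, and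
  \<open>step i = i + b i\<close>.  The lower bound for the gradient of \<open>f\<close> rests on one counting
  inequality.  For levels \<open>0 < t \<le> u\<close> let \<open>n\<close> and \<open>N\<close> be the sizes of \<open>{\<bar>f\<bar> > u}\<close> and \<open>{\<bar>f\<bar> > t}\<close>.
  The set \<open>{\<bar>f\<bar> > u}\<close> has at least \<open>b n\<close> boundary vertices, of which at most \<open>N - n\<close> lie above
  level \<open>t\<close>; so at least \<open>b n - (N - n)\<close> edges descend from above \<open>u\<close> to at most \<open>t\<close>.  On the other
  side, \<open>a i > u\<close> and \<open>a (step i) \<le> t\<close> mean \<open>i \<le> n\<close> and \<open>i + b i > N\<close>, and since \<open>b\<close> is
  nondecreasing this leaves at most \<open>b n - (N - n)\<close> indices \<open>i\<close>.  Hence across every strip there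
  are at least as many edges as intervals \<open>[i, step i]\<close> (\<open>card_crossing_steps_le\<close>).

  A convex power of a difference is a superposition of such strip crossings:
  \<open>(x - y)\<^sup>q\<close> is the integral over \<open>t \<in> [y, x)\<close> of the weight \<open>q (x - t)\<^sup>q\<^sup>-\<^sup>1\<close>, which
  increases with \<open>x\<close>.  At each level \<open>t\<close> the counting inequality, used for all \<open>u \<ge> t\<close>, says that
  the top values of the crossing edges dominate those of the crossing steps, and integration
  over \<open>t\<close> gives \<open>\<Sum>\<^sub>i (a i - a (step i))\<^sup>q \<le> \<Sum>\<^sub>e \<bar>\<nabla>f e\<bar>\<^sup>q\<close> (\<open>step_energy_le_gradient\<close>).

  Put \<open>k = \<lceil>c\<rceil> \<le> c + 1\<close>.  By the hypothesis on the enumeration, an edge whose first endpoint is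
  \<open>v i\<close> has its other endpoint at index at most \<open>i + k b i\<close>, hence within \<open>k\<close> steps from
  \<open>i\<close>, because \<open>b\<close> is nondecreasing.
  The iterates of \<open>step\<close> are injective, so Jensen's inequality bounds the energy of \<open>k\<close> steps by
  \<open>k\<^sup>q\<close> times that of single steps (\<open>step_iter_energy_le\<close>).  Each \<open>v i\<close> is the first endpoint of
  at most \<open>D\<close> edges, which gives the factor \<open>D\<close> before the \<open>q\<close>-th root is taken.  For the supremum
  norm the counting inequality alone shows that one step drops by at most the supremum of
  the edge differences.
\<close>

section \<open>Convex sums through level counts\<close>

text \<open>
  The hypothesis says that the family \<open>\<beta>\<close> dominates \<open>\<alpha>\<close> in sorted order.  Pairing the largest
  entry of \<open>\<alpha>\<close> with the largest entry of \<open>\<beta>\<close> and deleting both preserves it: below the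
  deleted \<open>\<alpha>\<close> both counts drop by one, and above it nothing of \<open>\<alpha>\<close> is left.\<close>

lemma sum_le_if_level_counts_le:
  fixes \<alpha> :: "'i \<Rightarrow> real" and \<beta> :: "'e \<Rightarrow> real" and \<psi> :: "real \<Rightarrow> real"
  assumes "finite A" and "finite B"
    and "\<And>u. card {i\<in>A. u < \<alpha> i} \<le> card {e\<in>B. u < \<beta> e}"
    and "mono \<psi>" and "\<And>x. 0 \<le> \<psi> x"
  shows "(\<Sum>i\<in>A. \<psi> (\<alpha> i)) \<le> (\<Sum>e\<in>B. \<psi> (\<beta> e))"
  using assms(1-3)
proof (induction "card A" arbitrary: A B)
  case 0
  then show ?case using assms(5) by (simp add: sum_nonneg)
next
  case (Suc m)
  have Ane: "A \<noteq> {}" using Suc.hyps(2) by auto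
  obtain a where a: "a \<in> A" "\<And>i. i \<in> A \<Longrightarrow> \<alpha> i \<le> \<alpha> a"
    using Max_in[of "\<alpha> ` A"] Max_ge[of "\<alpha> ` A"] Suc.prems(1) Ane by fastforce
  have "a \<in> {i\<in>A. \<alpha> a - 1 < \<alpha> i}" using a(1) by simp
  then have "0 < card {i\<in>A. \<alpha> a - 1 < \<alpha> i}" using Suc.prems(1) card_gt_0_iff by fastforce
  then have Bne: "B \<noteq> {}" using Suc.prems(3)[of "\<alpha> a - 1"] by auto
  obtain b where b: "b \<in> B" "\<And>e. e \<in> B \<Longrightarrow> \<beta> e \<le> \<beta> b"
    using Max_in[of "\<beta> ` B"] Max_ge[of "\<beta> ` B"] Suc.prems(2) Bne by fastforce
  have ab: "\<alpha> a \<le> \<beta> b"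
  proof (rule ccontr)
    assume "\<not> ?thesis"
    then have "a \<in> {i\<in>A. \<beta> b < \<alpha> i}" using a(1) by simp
    then have "0 < card {i\<in>A. \<beta> b < \<alpha> i}" using Suc.prems(1) card_gt_0_iff by fastforce
    moreover have empty: "{e\<in>B. \<beta> b < \<beta> e} = {}" using b(2) by force
    ultimately show False using Suc.prems(3)[of "\<beta> b"] unfolding empty by simp
  qed
  have counts: "card {i \<in> A - {a}. u < \<alpha> i} \<le> card {e \<in> B - {b}. u < \<beta> e}" for u
  proof (cases "u < \<alpha> a")
    case True
    have "{i \<in> A - {a}. u < \<alpha> i} = {i\<in>A. u < \<alpha> i} - {a}"
      and "{e \<in> B - {b}. u < \<beta> e} = {e\<in>B. u < \<beta> e} - {b}" by auto
    then show ?thesis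
      using Suc.prems a(1) b(1) True ab by (simp add: card_Diff_singleton diff_le_mono)
  next
    case False
    then have "{i \<in> A - {a}. u < \<alpha> i} = {}" using a(2) by force
    then show ?thesis by (metis card.empty zero_le)
  qed
  have "(\<Sum>i\<in>A - {a}. \<psi> (\<alpha> i)) \<le> (\<Sum>e\<in>B - {b}. \<psi> (\<beta> e))"
    using Suc.hyps Suc.prems a(1) counts by (intro Suc.hyps(1)) auto
  moreover have "\<psi> (\<alpha> a) \<le> \<psi> (\<beta> b)" using ab assms(4) by (rule monoD[rotated])
  ultimately show ?case
    using Suc.prems(1,2) a(1) b(1) by (simp add: sum.remove[of A a] sum.remove[of B b])
qed

text \<open>
  Minus the derivative of \<open>t \<mapsto> (x - t)\<^sup>q\<close>, extended by \<open>0\<close> to \<open>t \<ge> x\<close> so that it is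
  monotone in \<open>x\<close> on the whole line.  For \<open>q = 1\<close> it is the indicator of \<open>t < x\<close>, by the
  convention \<open>0 powr 0 = 0\<close>.\<close>

definition layer_weight :: "real \<Rightarrow> real \<Rightarrow> real \<Rightarrow> real" where
  "layer_weight q t x = q * (max 0 (x - t)) powr (q - 1)"

lemma layer_weight_nonneg: "1 \<le> q \<Longrightarrow> 0 \<le> layer_weight q t x"
  by (simp add: layer_weight_def)

lemma mono_layer_weight: "1 \<le> q \<Longrightarrow> mono (layer_weight q t)"
  unfolding layer_weight_def by (intro monoI mult_left_mono powr_mono2) auto

text \<open>
  The layers are half-open, \<open>b \<le> t < a\<close>, to match the level sets: a vertex lies above level
  \<open>t\<close> if its value is greater than \<open>t\<close>, and below otherwise.\<close>

lemma powr_diff_eq_nn_integral_layer_weight: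
  assumes "1 \<le> q" and "b \<le> a"
  shows "ennreal ((a - b) powr q) =
    (\<integral>\<^sup>+t. ennreal (indicator {b..<a} t * layer_weight q t a) \<partial>lborel)"
proof -
  have "((\<lambda>t. q * (a - t) powr (q - 1)) has_integral (- ((a - a) powr q) - - ((a - b) powr q))) {b..a}"
  proof (rule fundamental_theorem_of_calculus_interior[OF assms(2)])
    show "continuous_on {b..a} (\<lambda>t. - ((a - t) powr q))"
      using assms by (intro continuous_intros continuous_on_powr') auto
    fix t assume "t \<in> {b<..<a}"
    then show "((\<lambda>t. - ((a - t) powr q)) has_vector_derivative q * (a - t) powr (q - 1)) (at t)"
      unfolding has_real_derivative_iff_has_vector_derivative[symmetric]
      by (auto intro!: derivative_eq_intros simp: powr_diff)
  qed
  then have "((\<lambda>t. q * (a - t) powr (q - 1)) has_integral (a - b) powr q) {b..a}"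
    by simp
  then have "(\<integral>\<^sup>+t. ennreal (indicator {b..a} t * (q * (a - t) powr (q - 1))) \<partial>lborel)
      = ennreal ((a - b) powr q)"
    using assms(1) by (subst nn_integral_has_integral_lebesgue[symmetric]) auto
  moreover have "indicator {b..a} t * (q * (a - t) powr (q - 1))
      = indicator {b..<a} t * layer_weight q t a" for t
    by (auto simp: indicator_def layer_weight_def)
  ultimately show ?thesis by simp
qed

text \<open>
  Jensen's inequality for the uniform average.  Convexity is used on the open half-line,
  hence for the positive terms; the zero terms only increase the number \<open>k\<close> on the right-hand
  side.\<close>

lemma sum_powr_le:
  fixes x :: "nat \<Rightarrow> real"
  assumes q: "1 \<le> q" and x: "\<And>m. 0 \<le> x m"
  shows "(\<Sum>m<k. x m) powr q \<le> real k powr (q - 1) * (\<Sum>m<k. x m powr q)"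
proof -
  define S where "S = {m. m < k \<and> 0 < x m}"
  have fin: "finite S" by (simp add: S_def)
  have sum_S: "(\<Sum>m<k. h (x m)) = (\<Sum>m\<in>S. h (x m))" if "h 0 = 0" for h :: "real \<Rightarrow> real"
    using x that unfolding S_def by (intro sum.mono_neutral_right) (auto simp: order_less_le)
  show ?thesis
  proof (cases "S = {}")
    case True
    then show ?thesis using sum_S[of "\<lambda>x. x"] by (simp add: sum_nonneg)
  next
    case False
    define s where "s = real (card S)"
    have s: "0 < s" using fin False by (simp add: s_def card_gt_0_iff)
    have "card S \<le> card {..<k}" by (rule card_mono) (auto simp: S_def)
    then have sk: "s \<le> real k" by (simp add: s_def)
    have "(\<Sum>m\<in>S. (1 / s) *\<^sub>R x m) powr q \<le> (\<Sum>m\<in>S. (1 / s) * x m powr q)"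
      using fin False s by (intro convex_on_sum[OF _ _ powr_convex[OF q]]) (auto simp: S_def s_def)
    then have "(\<Sum>m\<in>S. x m) powr q / s powr q \<le> (\<Sum>m\<in>S. x m powr q) / s"
      using s x by (simp add: sum_divide_distrib[symmetric] powr_divide sum_nonneg)
    then have "(\<Sum>m\<in>S. x m) powr q \<le> s powr (q - 1) * (\<Sum>m\<in>S. x m powr q)"
      using s by (simp add: field_simps powr_diff)
    also have "\<dots> \<le> real k powr (q - 1) * (\<Sum>m\<in>S. x m powr q)"
      using s sk q by (intro mult_right_mono powr_mono2) (auto simp: sum_nonneg)
    finally show ?thesis
      using sum_S[of "\<lambda>x. x"] sum_S[of "\<lambda>x. x powr q"] by simp
  qed
qed

lemma nn_integral_count_space_subset:
  "A \<subseteq> B \<Longrightarrow> (\<integral>\<^sup>+i. h i \<partial>count_space A) \<le> (\<integral>\<^sup>+i. h i \<partial>count_space B)"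
  by (auto simp: nn_integral_count_space_indicator indicator_def intro!: nn_integral_mono)

lemma infsum_ennreal_eq_nn_integral:
  fixes h :: "'e \<Rightarrow> ennreal"
  assumes "countable A"
  shows "(\<Sum>\<^sub>\<infinity>e\<in>A. h e) = (\<integral>\<^sup>+e. h e \<partial>count_space A)"
proof (cases "finite A")
  case True
  then show ?thesis by (simp add: nn_integral_count_space_finite)
next
  case False
  then have bij: "bij_betw (from_nat_into A) UNIV A"
    using assms by (simp add: bij_betw_from_nat_into)
  have "(\<Sum>\<^sub>\<infinity>e\<in>A. h e) = (\<Sum>\<^sub>\<infinity>n. h (from_nat_into A n))"
    using infsum_reindex_bij_betw[OF bij, of h] by simp
  also have "\<dots> = (\<Sum>n. h (from_nat_into A n))"
    by (intro sums_unique has_sum_imp_sums has_sum_infsum nonneg_summable_on_complete) simp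
  also have "\<dots> = (\<integral>\<^sup>+e. h e \<partial>count_space A)"
    by (simp add: nn_integral_count_space_nat[symmetric] nn_integral_bij_count_space[OF bij])
  finally show ?thesis .
qed


section \<open>Decreasing rearrangement and level sets\<close>

text \<open>
  The sequence of largest values and the sizes of the level sets are inverse to each other.  For
  \<open>u = 0\<close> the level set may be infinite, with cardinality \<open>0\<close>.\<close>

lemma less_kth_largest_iff:
  assumes "infinite V" and van: "vanishes_at_infinity V f" and k: "1 \<le> k" and u: "0 < u"
  shows "u < kth_largest V f k \<longleftrightarrow> k \<le> card {x\<in>V. u < \<bar>f x\<bar>}"
proof -
  have fin: "finite {x\<in>V. u < \<bar>f x\<bar>}" using van u by (simp add: vanishes_at_infinity_def)
  show ?thesis
  proof
    assume less: "u < kth_largest V f k"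
    obtain S where S: "S \<subseteq> V" "card S = k" "\<forall>x\<in>S. kth_largest V f k \<le> \<bar>f x\<bar>"
      using kth_largest_attained(1)[OF assms(1) van k] by blast
    have "S \<subseteq> {x\<in>V. u < \<bar>f x\<bar>}" using S less by fastforce
    then show "k \<le> card {x\<in>V. u < \<bar>f x\<bar>}" using card_mono[OF fin] S(2) by blast
  next
    assume "k \<le> card {x\<in>V. u < \<bar>f x\<bar>}"
    then obtain S where S: "S \<subseteq> {x\<in>V. u < \<bar>f x\<bar>}" "card S = k" "finite S"
      by (rule obtain_subset_with_card_n)
    have ne: "S \<noteq> {}" using S(2) k by auto
    define m where "m = Min ((\<lambda>x. \<bar>f x\<bar>) ` S)"
    have um: "u < m" using S ne by (auto simp: m_def)
    have "S \<subseteq> V \<and> finite S \<and> card S = k \<and> (\<forall>x\<in>S. m \<le> \<bar>f x\<bar>)"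
      using S by (auto simp: m_def)
    then have "m \<le> kth_largest V f k"
      using um u by (intro kth_largest_attained(2)[OF assms(1) van k]) (auto simp: less_imp_le)
    with um show "u < kth_largest V f k" by simp
  qed
qed

lemma kth_largest_nonneg:
  assumes "infinite V" and "vanishes_at_infinity V f" and "1 \<le> k"
  shows "0 \<le> kth_largest V f k"
  using kth_largest_attained(1)[OF assms] by blast

lemma kth_largest_antimono:
  assumes "infinite V" and "vanishes_at_infinity V f" and "1 \<le> j" and "j \<le> k"
  shows "kth_largest V f k \<le> kth_largest V f j"
proof -
  obtain S where S: "0 \<le> kth_largest V f k" "S \<subseteq> V" "card S = k"
      "\<forall>x\<in>S. kth_largest V f k \<le> \<bar>f x\<bar>"
    using kth_largest_attained(1)[OF assms(1,2), of k] assms(3,4) by auto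
  obtain T where "T \<subseteq> S" "card T = j" "finite T"
    using assms(4) S(3) by (metis obtain_subset_with_card_n)
  then show ?thesis
    using S by (intro kth_largest_attained(2)[OF assms(1-3)]) auto
qed

section \<open>The rearranged values along the isoperimetric step\<close>

text \<open>
  The growth of the isoperimetric number is what makes \<open>step\<close> strictly increasing, and is the
  reason why \<open>k\<close> steps from \<open>i\<close> reach at least \<open>i + k b i\<close>.\<close>

locale isoperimetric_graph =
  fixes V :: "'a set" and E :: "'a set set" and D :: real and f :: "'a \<Rightarrow> real"
  assumes simple: "simple_graph V E" and infinite_V: "infinite V" and countable_V: "countable V"
    and degree: "degree_le V E D"
    and isoperimetric_Suc:
      "\<And>n. 1 \<le> n \<Longrightarrow> isoperimetric_number V E n \<le> isoperimetric_number V E (n + 1)"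
    and vanishing: "vanishes_at_infinity V f"
begin

abbreviation b :: "nat \<Rightarrow> nat" where "b \<equiv> isoperimetric_number V E"

abbreviation a :: "nat \<Rightarrow> real" where "a \<equiv> kth_largest V f"

definition step :: "nat \<Rightarrow> nat" where "step i = i + b i"

definition edge_max :: "'a set \<Rightarrow> real" where "edge_max e = Max ((\<lambda>x. \<bar>f x\<bar>) ` e)"

definition edge_min :: "'a set \<Rightarrow> real" where "edge_min e = Min ((\<lambda>x. \<bar>f x\<bar>) ` e)"

lemmas a_nonneg = kth_largest_nonneg[OF infinite_V vanishing]
lemmas a_antimono = kth_largest_antimono[OF infinite_V vanishing]

lemma edgeE:
  assumes "e \<in> E"
  obtains x y where "e = {x, y}" "x \<in> V" "y \<in> V" "x \<noteq> y" "adjacent E x y"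
  using assms simple unfolding simple_graph_def adjacent_def by blast

lemma adjacent_sym: "adjacent E x y \<Longrightarrow> adjacent E y x"
  by (simp add: adjacent_def insert_commute)

lemma countable_E: "countable E"
proof (rule countable_subset)
  show "E \<subseteq> (\<lambda>(x, y). {x, y}) ` (V \<times> V)" by (auto elim!: edgeE)
  show "countable ((\<lambda>(x, y). {x, y}) ` (V \<times> V))" using countable_V by simp
qed

lemma finite_neighbours: "x \<in> V \<Longrightarrow> finite {y. adjacent E x y}"
  using degree by (simp add: degree_le_def)

lemma card_neighbours: "x \<in> V \<Longrightarrow> real (card {y. adjacent E x y}) \<le> D"
  using degree by (simp add: degree_le_def)

lemma b_le_card_vertex_boundary:
  assumes "finite X" and "X \<subseteq> V"
  shows "b (card X) \<le> card (vertex_boundary V E X)"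
  unfolding isoperimetric_number_def using assms by (intro cINF_lower) auto

lemma b_mono:
  assumes "1 \<le> i" and "i \<le> j"
  shows "b i \<le> b j"
  using assms(2)
proof (induction j rule: dec_induct)
  case (step j)
  then show ?case using isoperimetric_Suc[of j] assms(1) by simp
qed simp

lemma step_iter_ge: "1 \<le> i \<Longrightarrow> i + k * b i \<le> (step ^^ k) i"
proof (induction k)
  case (Suc k)
  then have "b i \<le> b ((step ^^ k) i)" by (intro b_mono) auto
  with Suc show ?case by (simp add: step_def[of "(step ^^ k) i"])
qed simp

lemma step_iter_less: "1 \<le> i \<Longrightarrow> i < j \<Longrightarrow> (step ^^ k) i < (step ^^ k) j"
proof (induction k)
  case (Suc k)
  then have "b ((step ^^ k) i) \<le> b ((step ^^ k) j)"
    using step_iter_ge[of i k] by (intro b_mono) auto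
  with Suc show ?case
    by (simp add: step_def[of "(step ^^ k) i"] step_def[of "(step ^^ k) j"])
qed simp

lemma inj_on_step_iter: "inj_on (step ^^ k) {1..}"
proof (rule inj_onI)
  fix i j assume "i \<in> {1..}" "j \<in> {1..}" "(step ^^ k) i = (step ^^ k) j"
  then show "i = j"
    using step_iter_less[of i j k] step_iter_less[of j i k] by (cases i j rule: linorder_cases) simp_all
qed

lemma a_step_iter_le: "1 \<le> i \<Longrightarrow> a ((step ^^ Suc k) i) \<le> a ((step ^^ k) i)"
  using step_iter_ge[of i k] by (intro a_antimono) (auto simp: step_def)

lemma edge_min_max_bounds:
  assumes "e \<in> E"
  shows "0 \<le> edge_min e" and "edge_min e \<le> edge_max e" and "edge_max e - edge_min e \<le> edge_diff f e"
  using assms by (auto simp: edge_max_def edge_min_def edge_diff_doubleton elim!: edgeE)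

lemma finite_level: "0 < t \<Longrightarrow> finite {x\<in>V. t < \<bar>f x\<bar>}"
  using vanishing by (simp add: vanishes_at_infinity_def)

lemma finite_crossing_edges:
  assumes "0 < t"
  shows "finite {e\<in>E. edge_min e \<le> t \<and> t < edge_max e}"
proof (rule finite_subset)
  show "{e\<in>E. edge_min e \<le> t \<and> t < edge_max e} \<subseteq>
      (\<Union>x\<in>{x\<in>V. t < \<bar>f x\<bar>}. (\<lambda>y. {x, y}) ` {y. adjacent E x y})"
  proof
    fix e assume e: "e \<in> {e\<in>E. edge_min e \<le> t \<and> t < edge_max e}"
    then obtain x y where xy: "e = {x, y}" "x \<in> V" "y \<in> V" "adjacent E x y"
      by (auto elim: edgeE)
    have "t < \<bar>f x\<bar> \<or> t < \<bar>f y\<bar>" using e xy(1) by (auto simp: edge_max_def less_max_iff_disj)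
    then show "e \<in> (\<Union>x\<in>{x\<in>V. t < \<bar>f x\<bar>}. (\<lambda>y. {x, y}) ` {y. adjacent E x y})"
      using xy adjacent_sym[OF xy(4)] by (auto simp: insert_commute)
  qed
  show "finite (\<Union>x\<in>{x\<in>V. t < \<bar>f x\<bar>}. (\<lambda>y. {x, y}) ` {y. adjacent E x y})"
    using finite_level[OF assms] finite_neighbours by auto
qed

text \<open>
  In terms of ranks, the steps that cross the strip from \<open>u\<close> down to \<open>t\<close> start inside one level
  set and end outside the other.\<close>

lemma crossing_steps_eq:
  assumes "0 < t" and "0 < u"
  shows "{i. 1 \<le> i \<and> u < a i \<and> a (step i) \<le> t} =
    {i. 1 \<le> i \<and> i \<le> card {x\<in>V. u < \<bar>f x\<bar>} \<and> card {x\<in>V. t < \<bar>f x\<bar>} < step i}"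
proof -
  have "a (step i) \<le> t \<longleftrightarrow> card {x\<in>V. t < \<bar>f x\<bar>} < step i" if "1 \<le> i" for i
    using less_kth_largest_iff[OF infinite_V vanishing _ assms(1), of "step i"] that
    by (auto simp: step_def)
  then show ?thesis
    using less_kth_largest_iff[OF infinite_V vanishing _ assms(2)] by blast
qed

lemma finite_crossing_steps:
  assumes "0 < t" and "0 < u"
  shows "finite {i. 1 \<le> i \<and> u < a i \<and> a (step i) \<le> t}"
  unfolding crossing_steps_eq[OF assms] by simp

text \<open>
  With \<open>X\<close> and \<open>Y\<close> the level sets of \<open>u\<close> and \<open>t\<close>, both sides are compared with
  \<open>b (card X) - (card Y - card X)\<close>.  The crossing steps start in an interval of ranks of at most
  this length.  At least this many boundary vertices of \<open>X\<close> lie outside \<open>Y\<close>, and each gives its own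
  edge, because the two ends of such an edge are separated by the strip.\<close>

lemma card_crossing_steps_le:
  assumes t: "0 < t" and tu: "t \<le> u"
  shows "card {i. 1 \<le> i \<and> u < a i \<and> a (step i) \<le> t} \<le> card {e\<in>E. edge_min e \<le> t \<and> u < edge_max e}"
proof -
  define X where "X = {x\<in>V. u < \<bar>f x\<bar>}"
  define Y where "Y = {x\<in>V. t < \<bar>f x\<bar>}"
  define Z where "Z = vertex_boundary V E X - Y"
  have u: "0 < u" using t tu by simp
  have finX: "finite X" and finY: "finite Y" using finite_level t u by (auto simp: X_def Y_def)
  have XV: "X \<subseteq> V" and XY: "X \<subseteq> Y" using tu by (auto simp: X_def Y_def)
  \<comment> \<open>The truncated difference is intended: if \<open>b (card X) \<ge> card Y\<close>, the bound is \<open>card X\<close>,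
    which is right because ranks start at \<open>1\<close>.\<close>
  have "{i. 1 \<le> i \<and> u < a i \<and> a (step i) \<le> t} \<subseteq> {card Y - b (card X)<..card X}"
  proof
    fix i assume "i \<in> {i. 1 \<le> i \<and> u < a i \<and> a (step i) \<le> t}"
    then have i: "1 \<le> i" "i \<le> card X" "card Y < step i"
      unfolding crossing_steps_eq[OF t u] X_def Y_def by auto
    with b_mono[of i "card X"] show "i \<in> {card Y - b (card X)<..card X}"
      by (auto simp: step_def)
  qed
  then have "card {i. 1 \<le> i \<and> u < a i \<and> a (step i) \<le> t} \<le> card X - (card Y - b (card X))"
    using card_mono[OF finite_greaterThanAtMost] by fastforce
  also have "\<dots> \<le> b (card X) - (card Y - card X)"
    using card_mono[OF finY XY] by linarith
  also have "\<dots> \<le> card (vertex_boundary V E X) - card (Y - X)"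
    using b_le_card_vertex_boundary[OF finX XV] finX XY by (simp add: card_Diff_subset diff_le_mono)
  also have "\<dots> \<le> card (vertex_boundary V E X - (Y - X))"
    using finY by (intro diff_card_le_card_Diff) auto
  also have "vertex_boundary V E X - (Y - X) = Z"
    by (auto simp: Z_def vertex_boundary_def)
  also have "card Z \<le> card {e\<in>E. edge_min e \<le> t \<and> u < edge_max e}"
  proof -
    have "\<forall>z\<in>Z. \<exists>x\<in>X. {x, z} \<in> E"
      by (auto simp: Z_def vertex_boundary_def adjacent_def)
    then obtain w where w: "\<And>z. z \<in> Z \<Longrightarrow> w z \<in> X" "\<And>z. z \<in> Z \<Longrightarrow> {w z, z} \<in> E"
      by metis
    have low: "\<bar>f z\<bar> \<le> t" if "z \<in> Z" for z
      using that by (auto simp: Z_def Y_def vertex_boundary_def)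
    have high: "u < \<bar>f (w z)\<bar>" if "z \<in> Z" for z
      using w(1)[OF that] by (simp add: X_def)
    have "inj_on (\<lambda>z. {w z, z}) Z"
    proof (rule inj_onI)
      fix z z' assume "z \<in> Z" "z' \<in> Z" "{w z, z} = {w z', z'}"
      then show "z = z'" using low high tu by (fastforce simp: doubleton_eq_iff)
    qed
    moreover have "(\<lambda>z. {w z, z}) ` Z \<subseteq> {e\<in>E. edge_min e \<le> t \<and> u < edge_max e}"
      using w low high by (auto simp: edge_max_def edge_min_def min_le_iff_disj less_max_iff_disj)
    moreover have "finite {e\<in>E. edge_min e \<le> t \<and> u < edge_max e}"
      by (rule finite_subset[OF _ finite_crossing_edges[OF t]]) (use tu in auto)
    ultimately show ?thesis by (rule card_inj_on_le)
  qed
  finally show ?thesis .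
qed

text \<open>
  At a fixed level \<open>t\<close>, the counts for all \<open>u \<ge> t\<close> say that the top values of the crossing edges
  dominate those of the crossing steps, and the weight is monotone in the top value.\<close>

lemma layer_sum_le:
  assumes q: "1 \<le> q" and t: "0 < t"
  shows "(\<integral>\<^sup>+i. ennreal (indicator {a (step i)..<a i} t * layer_weight q t (a i)) \<partial>count_space {1..})
    \<le> (\<integral>\<^sup>+e. ennreal (indicator {edge_min e..<edge_max e} t * layer_weight q t (edge_max e)) \<partial>count_space E)"
proof -
  define A where "A = {i. 1 \<le> i \<and> t < a i \<and> a (step i) \<le> t}"
  define B where "B = {e\<in>E. edge_min e \<le> t \<and> t < edge_max e}"
  have finA: "finite A" and finB: "finite B"
    using finite_crossing_steps[OF t t] finite_crossing_edges[OF t] by (auto simp: A_def B_def)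
  have counts: "card {i\<in>A. u < a i} \<le> card {e\<in>B. u < edge_max e}" for u
  proof -
    \<comment> \<open>Elements of \<open>A\<close> and \<open>B\<close> already exceed \<open>t\<close>, so levels \<open>u < t\<close> reduce to \<open>u = t\<close>.\<close>
    have "{i\<in>A. u < a i} = {i. 1 \<le> i \<and> max u t < a i \<and> a (step i) \<le> t}"
      and "{e\<in>B. u < edge_max e} = {e\<in>E. edge_min e \<le> t \<and> max u t < edge_max e}"
      by (auto simp: A_def B_def)
    then show ?thesis using card_crossing_steps_le[OF t, of "max u t"] by simp
  qed
  have "(\<integral>\<^sup>+i. ennreal (indicator {a (step i)..<a i} t * layer_weight q t (a i)) \<partial>count_space {1..})
      = (\<Sum>i\<in>A. ennreal (indicator {a (step i)..<a i} t * layer_weight q t (a i)))"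
    using finA by (intro nn_integral_count_space') (auto simp: A_def indicator_def)
  also have "\<dots> = (\<Sum>i\<in>A. ennreal (layer_weight q t (a i)))"
    by (intro sum.cong) (auto simp: A_def)
  also have "\<dots> = ennreal (\<Sum>i\<in>A. layer_weight q t (a i))"
    by (intro sum_ennreal layer_weight_nonneg q)
  also have "\<dots> \<le> ennreal (\<Sum>e\<in>B. layer_weight q t (edge_max e))"
    using finA finB counts mono_layer_weight[OF q] layer_weight_nonneg[OF q]
    by (intro ennreal_leI sum_le_if_level_counts_le)
  also have "\<dots> = (\<Sum>e\<in>B. ennreal (layer_weight q t (edge_max e)))"
    by (intro sum_ennreal[symmetric] layer_weight_nonneg q)
  also have "\<dots> = (\<Sum>e\<in>B. ennreal (indicator {edge_min e..<edge_max e} t * layer_weight q t (edge_max e)))"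
    by (intro sum.cong) (auto simp: B_def)
  also have "\<dots> = (\<integral>\<^sup>+e. ennreal (indicator {edge_min e..<edge_max e} t * layer_weight q t (edge_max e)) \<partial>count_space E)"
    using finB by (intro nn_integral_count_space'[symmetric]) (auto simp: B_def indicator_def)
  finally show ?thesis .
qed

text \<open>
  Integrating the inequality between layers over \<open>t\<close>, with the sums and the integral exchanged
  by Tonelli's theorem.\<close>

lemma step_energy_le_gradient:
  assumes q: "1 \<le> q"
  shows "(\<integral>\<^sup>+i. ennreal ((a i - a (step i)) powr q) \<partial>count_space {1..})
    \<le> (\<integral>\<^sup>+e. ennreal (edge_diff f e powr q) \<partial>count_space E)"
proof -
  have [measurable]: "(\<lambda>t. ennreal (indicator {l..<h} t * layer_weight q t h)) \<in> borel_measurable lborel"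
    for l h unfolding layer_weight_def by measurable
  have "(\<integral>\<^sup>+i. ennreal ((a i - a (step i)) powr q) \<partial>count_space {1..})
    = (\<integral>\<^sup>+i. (\<integral>\<^sup>+t. ennreal (indicator {a (step i)..<a i} t * layer_weight q t (a i)) \<partial>lborel)
        \<partial>count_space {1..})"
    using a_step_iter_le[of _ 0]
    by (intro nn_integral_cong powr_diff_eq_nn_integral_layer_weight[OF q]) simp
  also have "\<dots> = (\<integral>\<^sup>+t. (\<integral>\<^sup>+i. ennreal (indicator {a (step i)..<a i} t * layer_weight q t (a i))
        \<partial>count_space {1..}) \<partial>lborel)"
    by (intro nn_integral_count_space_nn_integral[symmetric]) auto
  also have "\<dots> \<le> (\<integral>\<^sup>+t. (\<integral>\<^sup>+e. ennreal (indicator {edge_min e..<edge_max e} t * layer_weight q t (edge_max e))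
        \<partial>count_space E) \<partial>lborel)"
  proof (rule nn_integral_mono_AE)
    \<comment> \<open>The level \<open>t = 0\<close> is discarded: infinitely many steps or edges may cross it.\<close>
    have "AE t in lborel. t \<noteq> (0::real)" by (rule AE_lborel_singleton)
    then show "AE t in lborel. (\<integral>\<^sup>+i. ennreal (indicator {a (step i)..<a i} t * layer_weight q t (a i))
        \<partial>count_space {1..}) \<le> (\<integral>\<^sup>+e. ennreal (indicator {edge_min e..<edge_max e} t * layer_weight q t (edge_max e))
        \<partial>count_space E)"
    proof eventually_elim
      fix t :: real assume "t \<noteq> 0"
      show "(\<integral>\<^sup>+i. ennreal (indicator {a (step i)..<a i} t * layer_weight q t (a i))
          \<partial>count_space {1..}) \<le> (\<integral>\<^sup>+e. ennreal (indicator {edge_min e..<edge_max e} t * layer_weight q t (edge_max e))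
          \<partial>count_space E)"
      proof (cases "0 < t")
        case True
        then show ?thesis by (rule layer_sum_le[OF q])
      next
        case False
        then have "t < a (step i)" if "1 \<le> i" for i
          using a_nonneg[of "step i"] \<open>t \<noteq> 0\<close> that by (simp add: step_def)
        then have "(\<integral>\<^sup>+i. ennreal (indicator {a (step i)..<a i} t * layer_weight q t (a i))
            \<partial>count_space {1..}) = (\<integral>\<^sup>+i. 0 \<partial>count_space {1::nat..})"
          by (intro nn_integral_cong) (auto simp: indicator_def dest: leD)
        then show ?thesis by simp
      qed
    qed
  qed
  also have "\<dots> = (\<integral>\<^sup>+e. (\<integral>\<^sup>+t. ennreal (indicator {edge_min e..<edge_max e} t * layer_weight q t (edge_max e))
        \<partial>lborel) \<partial>count_space E)"
    by (intro nn_integral_count_space_nn_integral countable_E) simp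
  also have "\<dots> = (\<integral>\<^sup>+e. ennreal ((edge_max e - edge_min e) powr q) \<partial>count_space E)"
    by (intro nn_integral_cong powr_diff_eq_nn_integral_layer_weight[OF q, symmetric])
      (simp add: edge_min_max_bounds)
  also have "\<dots> \<le> (\<integral>\<^sup>+e. ennreal (edge_diff f e powr q) \<partial>count_space E)"
    using q by (intro nn_integral_mono ennreal_leI powr_mono2) (auto simp: edge_min_max_bounds)
  finally show ?thesis .
qed

lemma a_diff_step_iter:
  "a i - a ((step ^^ k) i) = (\<Sum>m<k. a ((step ^^ m) i) - a ((step ^^ Suc m) i))"
  using sum_lessThan_telescope'[of "\<lambda>m. a ((step ^^ m) i)" k] by simp

text \<open>
  Decompose \<open>k\<close> steps into single ones and apply Jensen's inequality.  For each \<open>m < k\<close>, the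
  \<open>m\<close>-th steps starting from all \<open>i\<close> are pairwise different single steps, so their energy is at
  most the total one; this is where injectivity is used.\<close>

lemma step_iter_energy_le:
  assumes q: "1 \<le> q"
  shows "(\<integral>\<^sup>+i. ennreal ((a i - a ((step ^^ k) i)) powr q) \<partial>count_space {1..})
    \<le> ennreal (real k powr q) * (\<integral>\<^sup>+i. ennreal ((a i - a (step i)) powr q) \<partial>count_space {1..})"
proof -
  let ?g = "\<lambda>i. ennreal ((a i - a (step i)) powr q)"
  let ?I = "\<integral>\<^sup>+i. ?g i \<partial>count_space {1..}"
  have shift: "(\<integral>\<^sup>+i. ?g ((step ^^ m) i) \<partial>count_space {1..}) \<le> ?I" for m
  proof -
    have "(\<integral>\<^sup>+i. ?g ((step ^^ m) i) \<partial>count_space {1..})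
        = (\<integral>\<^sup>+j. ?g j \<partial>count_space ((step ^^ m) ` {1..}))"
      by (intro nn_integral_bij_count_space inj_on_imp_bij_betw inj_on_step_iter)
    also have "\<dots> \<le> ?I"
      using step_iter_ge[of _ m] by (intro nn_integral_count_space_subset) fastforce
    finally show ?thesis .
  qed
  have "(\<integral>\<^sup>+i. ennreal ((a i - a ((step ^^ k) i)) powr q) \<partial>count_space {1..})
    \<le> (\<integral>\<^sup>+i. ennreal (real k powr (q - 1)) * (\<Sum>m<k. ?g ((step ^^ m) i)) \<partial>count_space {1..})"
  proof (rule nn_integral_mono)
    fix i assume "i \<in> space (count_space {1::nat..})"
    then have i: "1 \<le> i" by simp
    have "(a i - a ((step ^^ k) i)) powr q
      \<le> real k powr (q - 1) * (\<Sum>m<k. (a ((step ^^ m) i) - a ((step ^^ Suc m) i)) powr q)"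
      unfolding a_diff_step_iter using a_step_iter_le[OF i] by (intro sum_powr_le[OF q]) simp
    then show "ennreal ((a i - a ((step ^^ k) i)) powr q)
      \<le> ennreal (real k powr (q - 1)) * (\<Sum>m<k. ?g ((step ^^ m) i))"
      by (simp add: sum_ennreal ennreal_mult[symmetric] sum_nonneg ennreal_leI)
  qed
  also have "\<dots> = ennreal (real k powr (q - 1)) *
      (\<Sum>m<k. \<integral>\<^sup>+i. ?g ((step ^^ m) i) \<partial>count_space {1..})"
    by (simp add: nn_integral_cmult nn_integral_sum del: sum_ennreal)
  also have "\<dots> \<le> ennreal (real k powr (q - 1)) * (\<Sum>m<k. ?I)"
    by (intro mult_left_mono sum_mono shift) simp
  also have "\<dots> = ennreal (real k powr (q - 1)) * ennreal (real k) * ?I"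
    by (simp add: mult.assoc ennreal_of_nat_eq_real_of_nat)
  also have "ennreal (real k powr (q - 1)) * ennreal (real k) = ennreal (real k powr q)"
    by (cases "k = 0") (simp_all add: ennreal_mult[symmetric] powr_diff)
  finally show ?thesis .
qed

text \<open>
  Any strip strictly inside the drop of one step is crossed by that step, hence by an edge.  The
  strip has to be shrunk by \<open>d / 2\<close> on both sides because \<open>a i\<close> has to exceed its upper level and
  its lower level has to be positive.\<close>

lemma step_diff_le_bound:
  assumes i: "1 \<le> i" and S: "\<And>e. e \<in> E \<Longrightarrow> edge_diff f e \<le> S" and "0 \<le> S"
  shows "a i - a (step i) \<le> S"
proof -
  have bound: "u - t \<le> S" if t: "0 < t" "a (step i) \<le> t" and tu: "t \<le> u" and u: "u < a i" for t u
  proof -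
    have "i \<in> {i. 1 \<le> i \<and> u < a i \<and> a (step i) \<le> t}" using i that by simp
    then have "0 < card {i. 1 \<le> i \<and> u < a i \<and> a (step i) \<le> t}"
      using finite_crossing_steps[OF t(1), of u] t(1) tu by (auto simp: card_gt_0_iff)
    then have "{e\<in>E. edge_min e \<le> t \<and> u < edge_max e} \<noteq> {}"
      using card_crossing_steps_le[OF t(1) tu] by (metis card.empty not_le)
    then obtain e where e: "e \<in> E" "edge_min e \<le> t" "u < edge_max e" by blast
    with edge_min_max_bounds(3)[OF e(1)] S[OF e(1)] show ?thesis by linarith
  qed
  show ?thesis
  proof (rule field_le_epsilon)
    fix d :: real assume d: "0 < d"
    have nonneg: "0 \<le> a (step i)" using i by (intro a_nonneg) (simp add: step_def)
    show "a i - a (step i) \<le> S + d"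
    proof (cases "a i - a (step i) \<le> d")
      case False
      then show ?thesis
        using bound[of "a (step i) + d / 2" "a i - d / 2"] nonneg d by (simp add: field_simps)
    qed (use assms(3) in simp)
  qed
qed

lemma step_iter_diff_le_bound:
  assumes "1 \<le> i" and "\<And>e. e \<in> E \<Longrightarrow> edge_diff f e \<le> S" and "0 \<le> S"
  shows "a i - a ((step ^^ k) i) \<le> real k * S"
proof -
  have "a ((step ^^ m) i) - a ((step ^^ Suc m) i) \<le> S" for m
    using step_diff_le_bound[of "(step ^^ m) i" S] assms step_iter_ge[of i m] by simp
  then have "(\<Sum>m<k. a ((step ^^ m) i) - a ((step ^^ Suc m) i)) \<le> (\<Sum>m<k. S)"
    by (rule sum_mono)
  then show ?thesis by (simp add: a_diff_step_iter)
qed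

end

section \<open>Edges after rearrangement\<close>

text \<open>
  The constant \<open>c\<close> is rounded up to the natural number \<open>k\<close>, so that an interval of length
  \<open>k b n\<close> is covered by \<open>k\<close> steps.\<close>

locale isoperimetric_enumeration = isoperimetric_graph +
  fixes v :: "nat \<Rightarrow> 'a" and k :: nat
  assumes enum: "bij_betw v {1..} V"
    and near: "\<And>n. 1 \<le> n \<Longrightarrow> vertex_boundary V E (v ` {1..n}) \<subseteq> {v j |j. n + 1 \<le> j \<and> j \<le> n + k * b n}"
begin

definition lower_end :: "'a set \<Rightarrow> nat" where "lower_end e = Min (inv_into {1..} v ` e)"

lemma v_inj: "1 \<le> i \<Longrightarrow> 1 \<le> j \<Longrightarrow> v i = v j \<longleftrightarrow> i = j"
  using enum by (auto simp: bij_betw_def inj_on_def)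

lemma edge_lower_endE:
  assumes "e \<in> E"
  obtains j where "e = {v (lower_end e), v j}" "1 \<le> lower_end e" "lower_end e < j"
    "adjacent E (v (lower_end e)) (v j)"
proof -
  note conclude = that
  have *: thesis if e: "e = {v i, v j}" and i: "1 \<le> i" and ij: "i < j" for i j
  proof -
    have "inv_into {1..} v (v i) = i" and "inv_into {1..} v (v j) = j"
      using enum i ij by (simp_all add: bij_betw_inv_into_left)
    then have "lower_end e = i" using ij by (simp add: lower_end_def e)
    then show thesis using conclude[of j] e i ij assms by (simp add: adjacent_def)
  qed
  obtain x y where xy: "e = {x, y}" "x \<in> V" "y \<in> V" "x \<noteq> y" using assms by (rule edgeE)
  obtain i j where ij: "1 \<le> i" "x = v i" "1 \<le> j" "y = v j"
    using xy(2,3) enum by (auto simp: bij_betw_def)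
  consider "i < j" | "j < i" using ij xy(4) by fastforce
  then show thesis
    using *[of i j] *[of j i] ij xy(1) by cases (auto simp: insert_commute)
qed

text \<open>
  If \<open>v i\<close> is the first endpoint of the edge, then the other endpoint lies in the boundary of the
  initial segment \<open>v ` {1..i}\<close>, so its index is at most \<open>i + k b i\<close>, which \<open>k\<close> steps reach.\<close>

lemma edge_diff_rearrangement_le:
  assumes "e \<in> E"
  shows "edge_diff (rearrangement V v f) e \<le> a (lower_end e) - a ((step ^^ k) (lower_end e))"
proof -
  define i where "i = lower_end e"
  obtain j where e: "e = {v i, v j}" and i: "1 \<le> i" and ij: "i < j" and adj: "adjacent E (v i) (v j)"
    using edge_lower_endE[OF assms] unfolding i_def by metis
  have "v j \<in> vertex_boundary V E (v ` {1..i})"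
  proof -
    have "v j \<noteq> v l" if "1 \<le> l" "l \<le> i" for l using v_inj[of j l] that ij by simp
    then have "v j \<notin> v ` {1..i}" by (metis atLeastAtMost_iff imageE)
    moreover have "v j \<in> V" using enum i ij by (auto simp: bij_betw_def)
    ultimately show ?thesis using adj i by (auto simp: vertex_boundary_def)
  qed
  then obtain j' where "v j = v j'" "i + 1 \<le> j'" "j' \<le> i + k * b i"
    using near[OF i] by blast
  then have "j \<le> i + k * b i" using v_inj[of j j'] ij i by auto
  then have "j \<le> (step ^^ k) i" using step_iter_ge[OF i, of k] by simp
  then have "a ((step ^^ k) i) \<le> a j" using ij i by (intro a_antimono) auto
  moreover have "a j \<le> a i" using ij i by (intro a_antimono) auto
  moreover have "edge_diff (rearrangement V v f) e = \<bar>a i - a j\<bar>"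
    using i ij enum by (simp add: e edge_diff_doubleton rearrangement_enumeration)
  ultimately show ?thesis by (simp add: i_def)
qed

lemma emeasure_lower_end_fibre_le:
  assumes "1 \<le> i"
  shows "emeasure (count_space E) {e\<in>E. lower_end e = i} \<le> ennreal D"
proof -
  let ?N = "{y. adjacent E (v i) y}"
  have vi: "v i \<in> V" using assms enum by (auto simp: bij_betw_def)
  have sub: "{e\<in>E. lower_end e = i} \<subseteq> (\<lambda>y. {v i, y}) ` ?N"
    by (auto elim: edge_lower_endE)
  have fin: "finite {e\<in>E. lower_end e = i}"
    using sub finite_neighbours[OF vi] by (meson finite_imageI finite_subset)
  have "card {e\<in>E. lower_end e = i} \<le> card ?N"
    using sub finite_neighbours[OF vi] by (meson card_image_le card_mono finite_imageI le_trans)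
  then have "real (card {e\<in>E. lower_end e = i}) \<le> D" using card_neighbours[OF vi] by simp
  then show ?thesis
    using fin by (simp add: emeasure_count_space_finite ennreal_of_nat_eq_real_of_nat ennreal_leI)
qed

text \<open>
  The edges are grouped by their first endpoint: a group has at most \<open>D\<close> members, all bounded
  by the same drop over \<open>k\<close> steps.\<close>

lemma gradient_rearrangement_le:
  assumes q: "1 \<le> q"
  shows "(\<integral>\<^sup>+e. ennreal (edge_diff (rearrangement V v f) e powr q) \<partial>count_space E)
    \<le> ennreal D * ennreal (real k powr q) * (\<integral>\<^sup>+e. ennreal (edge_diff f e powr q) \<partial>count_space E)"
proof -
  let ?h = "\<lambda>i. ennreal ((a i - a ((step ^^ k) i)) powr q)"
  have "(\<integral>\<^sup>+e. ennreal (edge_diff (rearrangement V v f) e powr q) \<partial>count_space E)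
    \<le> (\<integral>\<^sup>+e. (\<integral>\<^sup>+i. ?h i * indicator {e\<in>E. lower_end e = i} e \<partial>count_space {1..}) \<partial>count_space E)"
  proof (rule nn_integral_mono)
    fix e assume "e \<in> space (count_space E)"
    then have e: "e \<in> E" by simp
    have le: "1 \<le> lower_end e" using e by (rule edge_lower_endE)
    have "0 \<le> edge_diff (rearrangement V v f) e"
      using e by (auto elim!: edgeE simp: edge_diff_doubleton)
    then have "ennreal (edge_diff (rearrangement V v f) e powr q) \<le> ?h (lower_end e)"
      using edge_diff_rearrangement_le[OF e] q by (intro ennreal_leI powr_mono2) auto
    also have "\<dots> = ?h (lower_end e) * indicator {e'\<in>E. lower_end e' = lower_end e} e"
      using e by simp
    also have "\<dots> \<le> (\<integral>\<^sup>+i. ?h i * indicator {e\<in>E. lower_end e = i} e \<partial>count_space {1..})"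
      using le by (intro nn_integral_ge_point[where p="\<lambda>i. ?h i * indicator {e\<in>E. lower_end e = i} e"]) simp
    finally show "ennreal (edge_diff (rearrangement V v f) e powr q)
      \<le> (\<integral>\<^sup>+i. ?h i * indicator {e\<in>E. lower_end e = i} e \<partial>count_space {1..})" .
  qed
  also have "\<dots> = (\<integral>\<^sup>+i. (\<integral>\<^sup>+e. ?h i * indicator {e\<in>E. lower_end e = i} e \<partial>count_space E) \<partial>count_space {1..})"
    by (intro nn_integral_count_space_nn_integral) auto
  also have "\<dots> = (\<integral>\<^sup>+i. ?h i * emeasure (count_space E) {e\<in>E. lower_end e = i} \<partial>count_space {1..})"
    by (intro nn_integral_cong nn_integral_cmult_indicator) auto
  also have "\<dots> \<le> (\<integral>\<^sup>+i. ?h i * ennreal D \<partial>count_space {1..})"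
    by (intro nn_integral_mono mult_left_mono emeasure_lower_end_fibre_le) auto
  also have "\<dots> = ennreal D * (\<integral>\<^sup>+i. ?h i \<partial>count_space {1..})"
    by (subst nn_integral_multc) (simp_all add: mult.commute)
  also have "\<dots> \<le> ennreal D * (ennreal (real k powr q) *
      (\<integral>\<^sup>+e. ennreal (edge_diff f e powr q) \<partial>count_space E))"
    by (intro mult_left_mono order_trans[OF step_iter_energy_le[OF q]] step_energy_le_gradient q) auto
  finally show ?thesis by (simp add: mult.assoc)
qed

lemma gradient_sup_rearrangement_le:
  assumes "e \<in> E"
  shows "ennreal (edge_diff (rearrangement V v f) e)
    \<le> ennreal (real k) * (SUP e\<in>E. ennreal (edge_diff f e))"
proof (cases "k = 0")
  case True
  then show ?thesis using edge_diff_rearrangement_le[OF assms] by (simp add: ennreal_neg)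
next
  case False
  show ?thesis
  proof (cases "(SUP e\<in>E. ennreal (edge_diff f e))")
    case (real S)
    have "edge_diff f e' \<le> S" if "e' \<in> E" for e'
      using SUP_upper[OF that, of "\<lambda>e. ennreal (edge_diff f e)"] real by simp
    moreover have "1 \<le> lower_end e" using assms by (rule edge_lower_endE)
    ultimately have "a (lower_end e) - a ((step ^^ k) (lower_end e)) \<le> real k * S"
      using real(1) by (intro step_iter_diff_le_bound) auto
    with edge_diff_rearrangement_le[OF assms]
    have "edge_diff (rearrangement V v f) e \<le> real k * S" by (rule order_trans)
    then show ?thesis using real by (simp add: ennreal_mult[symmetric] ennreal_leI)
  next
    case top
    then show ?thesis using False by (simp only:) simp
  qed
qed

end

section \<open>Gradient norms\<close>

lemma ennreal_power_le:
  assumes le: "x \<le> ennreal D * ennreal (K powr q) * y" and "0 < D" and "0 < K" and "0 < q"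
  shows "ennreal_power x (1 / q) \<le> ennreal K * ennreal (D powr (1 / q)) * ennreal_power y (1 / q)"
proof (cases y)
  case top
  then show ?thesis using assms by (simp add: ennreal_power_def ennreal_mult_eq_top_iff)
next
  case (real s)
  then have "x \<le> ennreal (D * K powr q * s)" using assms by (simp add: ennreal_mult)
  then obtain r where r: "x = ennreal r" "0 \<le> r" "r \<le> D * K powr q * s"
    using real assms by (cases x) (auto simp: top_unique)
  have "r powr (1 / q) \<le> (D * K powr q * s) powr (1 / q)"
    using r assms by (intro powr_mono2) auto
  also have "\<dots> = K * D powr (1 / q) * s powr (1 / q)"
    using assms real by (simp add: powr_mult powr_powr)
  finally show ?thesis
    using r real assms by (simp add: ennreal_power_def ennreal_mult[symmetric] ennreal_leI)
qed

theorem theorem1p6: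
  fixes V :: "'a set" and E :: "'a set set" and D c :: real and v :: "nat \<Rightarrow> 'a"
    and p :: ennreal and f :: "'a \<Rightarrow> real"
  assumes "simple_graph V E" and "infinite V" and "countable V" and "connected_graph V E"
    and "\<And>n. n \<ge> 1 \<Longrightarrow> isoperimetric_number V E (n + 1) \<ge> isoperimetric_number V E n"
    and "\<And>n. n \<ge> 1 \<Longrightarrow> isoperimetric_number V E n \<ge> isoperimetric_number V E 1"
    and "isoperimetric_number V E 1 \<ge> 2"
    and "degree_le V E D"
    and "bij_betw v {1..} V"
    and "c > 0"
    and "\<And>n. n \<ge> 1 \<Longrightarrow> vertex_boundary V E (v ` {1..n}) \<subseteq>
           {v j |j. n + 1 \<le> j \<and> real j \<le> real n + c * real (isoperimetric_number V E n)}"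
    and "1 \<le> p"
    and "vanishes_at_infinity V f"
  shows "gradient_norm E p (rearrangement V v f)
           \<le> ennreal (c + 1) * ennreal (D powr enn2real (1 / p)) * gradient_norm E p f"
proof -
  define k where "k = nat \<lceil>c\<rceil>"
  have k: "0 < k" "c \<le> real k" "real k \<le> c + 1"
    using assms(10) by (auto simp: k_def)
  interpret isoperimetric_graph V E D f
    using assms(1-3,5,8,13) by unfold_locales auto
  interpret isoperimetric_enumeration V E D f v k
  proof
    fix n :: nat assume n: "1 \<le> n"
    have "j \<le> n + k * b n" if "real j \<le> real n + c * real (b n)" for j
    proof -
      have "real j \<le> real n + real k * real (b n)"
        using that k(2) mult_right_mono[of c "real k" "real (b n)"] by simp
      then show ?thesis by (metis of_nat_add of_nat_le_iff of_nat_mult)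
    qed
    then show "vertex_boundary V E (v ` {1..n}) \<subseteq> {v j |j. n + 1 \<le> j \<and> j \<le> n + k * b n}"
      using assms(11)[OF n] by blast
  qed (rule assms(9))
  have D: "0 < D"
  proof -
    obtain x where x: "x \<in> V" using infinite_V by fastforce
    have "2 \<le> card (vertex_boundary V E {x})"
      using b_le_card_vertex_boundary[of "{x}"] x assms(7) by simp
    also have "\<dots> \<le> card {y. adjacent E x y}"
      by (intro card_mono finite_neighbours x) (auto simp: vertex_boundary_def)
    finally show ?thesis using card_neighbours[OF x] by linarith
  qed
  have "gradient_norm E p (rearrangement V v f)
      \<le> ennreal (real k) * ennreal (D powr enn2real (1 / p)) * gradient_norm E p f"
  proof (cases p)
    case top
    then show ?thesis
      using D gradient_sup_rearrangement_le by (auto simp: gradient_norm_def intro!: SUP_least)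
  next
    case (real q)
    have q: "1 \<le> q" using assms(12) real by simp
    have "enn2real (1 / p) = 1 / q"
      using real q divide_ennreal[of 1 q] by simp
    then show ?thesis
      using real q ennreal_power_le[OF gradient_rearrangement_le[OF q] D] k(1)
      by (simp add: gradient_norm_def infsum_ennreal_eq_nn_integral[OF countable_E])
  qed
  also have "\<dots> \<le> ennreal (c + 1) * ennreal (D powr enn2real (1 / p)) * gradient_norm E p f"
    using k(3) by (intro mult_right_mono ennreal_leI) auto
  finally show ?thesis .
qed

end
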